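(* Let $\hat g,g:\mathbb{R}\to\mathbb{R}$ be two arbitrary differentiable, monotone increasing and strictly convex functions. If $x^*$ is an optimal solution of the convex program $\mathscr{P}^{\hat g}$, then $x^*$ is also an optimal solution of $\mathscr{P}^{g}$.
   Context: $G=(D,S,E)$ is a finite bipartite graph with $D=D_1\cup D_2$ (disjoint), supply weights $w_j>0$ ($j\in S$); for $i\in D_1$, $N(i)$ is its neighbourhood in $S$, and for $j\in S$, $N(j)$ is its neighbourhood in $D_1$. For a function $h$, $\mathscr{P}^h$ is the program: minimize $\sum_{j\in S}\frac{1}{w_j}h\big(w_j(1-\sum_{i\in N(j)}x_{ij})\big)$ subject to $\sum_{j\in N(i)}x_{ij}\le1$ ($i\in D_1$), $\sum_{i\in N(j)}x_{ij}\le1$ ($j\in S$), $x_{ij}\ge0$ ($(i,j)\in E$, $i\in D_1$). *)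

theory Defs
  imports "HOL-Analysis.Analysis"
begin

definition strictly_convex_on :: "'a::real_vector set \<Rightarrow> ('a \<Rightarrow> real) \<Rightarrow> bool" where
  "strictly_convex_on A f \<longleftrightarrow> convex A \<and>
     (\<forall>x\<in>A. \<forall>y\<in>A. \<forall>u>0. \<forall>v>0. x \<noteq> y \<longrightarrow> u + v = 1 \<longrightarrow>
        f (u *\<^sub>R x + v *\<^sub>R y) < u * f x + v * f y)"

text \<open>
  Demand vertices and supply vertices live in two separate types, and an edge is a pair
  (demand vertex, supply vertex).
\<close>

definition bipartite_graph :: "'d set \<Rightarrow> 's set \<Rightarrow> ('d \<times> 's) set \<Rightarrow> bool" where
  "bipartite_graph D S E \<longleftrightarrow> finite D \<and> finite S \<and> E \<subseteq> D \<times> S"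

definition supply_nbrs :: "'s set \<Rightarrow> ('d \<times> 's) set \<Rightarrow> 'd \<Rightarrow> 's set" where
  "supply_nbrs S E i = {j \<in> S. (i, j) \<in> E}"

definition demand_nbrs :: "'d set \<Rightarrow> ('d \<times> 's) set \<Rightarrow> 's \<Rightarrow> 'd set" where
  "demand_nbrs D1 E j = {i \<in> D1. (i, j) \<in> E}"

text \<open>
  A point of the program is a function \<open>x\<close>, where \<open>x i j\<close> is the variable of the edge
  \<open>(i, j)\<close> with \<open>i \<in> D1\<close>. The values of \<open>x\<close> at all other pairs are irrelevant: they occur
  neither in the constraints nor in the objective.
\<close>

definition feasible ::
  "'d set \<Rightarrow> 's set \<Rightarrow> ('d \<times> 's) set \<Rightarrow> ('d \<Rightarrow> 's \<Rightarrow> real) \<Rightarrow> bool" where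
  "feasible D1 S E x \<longleftrightarrow>
     (\<forall>i\<in>D1. (\<Sum>j\<in>supply_nbrs S E i. x i j) \<le> 1) \<and>
     (\<forall>j\<in>S. (\<Sum>i\<in>demand_nbrs D1 E j. x i j) \<le> 1) \<and>
     (\<forall>(i, j)\<in>E. i \<in> D1 \<longrightarrow> 0 \<le> x i j)"

definition objective ::
  "'d set \<Rightarrow> 's set \<Rightarrow> ('d \<times> 's) set \<Rightarrow> ('s \<Rightarrow> real) \<Rightarrow> (real \<Rightarrow> real) \<Rightarrow> ('d \<Rightarrow> 's \<Rightarrow> real) \<Rightarrow> real"
where
  "objective D1 S E w h x =
     (\<Sum>j\<in>S. 1 / w j * h (w j * (1 - (\<Sum>i\<in>demand_nbrs D1 E j. x i j))))"

definition optimal_solution ::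
  "'d set \<Rightarrow> 's set \<Rightarrow> ('d \<times> 's) set \<Rightarrow> ('s \<Rightarrow> real) \<Rightarrow> (real \<Rightarrow> real) \<Rightarrow> ('d \<Rightarrow> 's \<Rightarrow> real) \<Rightarrow> bool"
where
  "optimal_solution D1 S E w h x \<longleftrightarrow> is_arg_min (objective D1 S E w h) (feasible D1 S E) x"

end

theory Submission
  imports Defs
begin

text \<open>
  Write \<open>t j = w j * (1 - load j)\<close>. Moving load has marginal gain \<open>h' (t j)\<close> at \<open>j\<close>.
  Optimality for \<open>g_hat\<close>, whose derivative is positive and strictly increasing, rules out
  alternating paths that raise the load of an unsaturated vertex of an upper level set \<open>A\<close>
  of \<open>t\<close> while lowering only a load outside \<open>A\<close> or using a slack demand vertex. As in Koenig's
  theorem, the vertices reachable by alternating paths then certify that \<open>x\<close> maximises the total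
  load of \<open>A\<close>. As \<open>g' \<circ> t\<close> is a nonnegative combination of indicators of upper level
  sets of \<open>t\<close>, \<open>x\<close> also satisfies the first-order condition for \<open>g\<close>, which is sufficient by
  convexity.
\<close>

section \<open>Differentiable strictly convex functions\<close>

lemma strictly_convex_on_imp_convex_on:
  assumes "strictly_convex_on A f"
  shows "convex_on A f"
proof (rule convex_onI)
  show "convex A" using assms by (simp add: strictly_convex_on_def)
  fix t :: real and x y assume t: "0 < t" "t < 1" and xy: "x \<in> A" "y \<in> A"
  show "f ((1 - t) *\<^sub>R x + t *\<^sub>R y) \<le> (1 - t) * f x + t * f y"
  proof (cases "x = y")
    case True
    then show ?thesis by (simp add: algebra_simps)
  next
    case False
    then have "f ((1 - t) *\<^sub>R x + t *\<^sub>R y) < (1 - t) * f x + t * f y"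
      using assms t xy unfolding strictly_convex_on_def by simp
    then show ?thesis by simp
  qed
qed

lemma strictly_convex_above_tangent:
  fixes f :: "real \<Rightarrow> real"
  assumes "strictly_convex_on UNIV f" and "(f has_real_derivative f') (at a)"
  shows "f a + f' * (b - a) \<le> f b"
  using convex_on_imp_above_tangent[OF strictly_convex_on_imp_convex_on[OF assms(1)], of a b f']
    assms(2) by (simp add: algebra_simps)

text \<open>The midpoint of \<open>a\<close> and \<open>b\<close> already satisfies the weak tangent
  inequality, and its value lies strictly below the chord.\<close>

lemma strictly_convex_strictly_above_tangent:
  fixes f :: "real \<Rightarrow> real"
  assumes "strictly_convex_on UNIV f" and "(f has_real_derivative f') (at a)" and "b \<noteq> a"
  shows "f a + f' * (b - a) < f b"
proof -
  have "f ((1/2) *\<^sub>R a + (1/2) *\<^sub>R b) < 1/2 * f a + 1/2 * f b"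
    by (rule assms(1)[unfolded strictly_convex_on_def, THEN conjunct2, rule_format])
      (use assms(3) in auto)
  moreover have "f a + f' * (((1/2) *\<^sub>R a + (1/2) *\<^sub>R b) - a) \<le> f ((1/2) *\<^sub>R a + (1/2) *\<^sub>R b)"
    by (rule strictly_convex_above_tangent[OF assms(1,2)])
  moreover have "f' * (((1/2) *\<^sub>R a + (1/2) *\<^sub>R b) - a) = f' * (b - a) / 2"
    by (simp add: field_simps)
  ultimately show ?thesis by linarith
qed

text \<open>Add the strict tangent inequalities at \<open>a\<close> and at \<open>b\<close>, each
  evaluated at the other point.\<close>

lemma strictly_convex_deriv_strict_mono:
  fixes f :: "real \<Rightarrow> real"
  assumes "strictly_convex_on UNIV f" and "\<And>a. (f has_real_derivative f' a) (at a)" and "a < b"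
  shows "f' a < f' b"
proof -
  have "f a + f' a * (b - a) < f b" "f b + f' b * (a - b) < f a"
    using strictly_convex_strictly_above_tangent[OF assms(1,2)] assms(3) by auto
  then have "f' a * (b - a) < f' b * (b - a)" by (simp add: algebra_simps)
  then show ?thesis using assms(3) by simp
qed

text \<open>Monotonicity makes the slope at \<open>a - 1\<close> nonnegative; strict growth of the
  slope makes it positive one unit further right.\<close>

lemma mono_strictly_convex_deriv_pos:
  fixes f :: "real \<Rightarrow> real"
  assumes "strictly_convex_on UNIV f" and "\<And>a. (f has_real_derivative f' a) (at a)" and "mono f"
  shows "0 < f' a"
proof -
  have "f (a - 1) + f' (a - 1) * ((a - 2) - (a - 1)) \<le> f (a - 2)"
    by (rule strictly_convex_above_tangent[OF assms(1,2)])
  moreover have "f (a - 2) \<le> f (a - 1)" using assms(3) by (simp add: monoD)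
  ultimately have "0 \<le> f' (a - 1)" by simp
  also have "\<dots> < f' a" by (rule strictly_convex_deriv_strict_mono[OF assms(1,2)]) simp
  finally show ?thesis .
qed

section \<open>Layer-cake decomposition\<close>

text \<open>Induction on the size of the support of \<open>f\<close>: peel off \<open>m\<close>
  times the indicator of the support, where \<open>m\<close> is the least positive value. A
  minimiser leaves the support.\<close>

lemma weighted_sum_nonpos_if_level_sums_nonpos:
  fixes f \<delta> :: "'a \<Rightarrow> real"
  assumes "finite S" and "\<And>j. j \<in> S \<Longrightarrow> 0 \<le> f j"
    and "\<And>c. 0 < c \<Longrightarrow> (\<Sum>j\<in>{j \<in> S. c \<le> f j}. \<delta> j) \<le> 0"
  shows "(\<Sum>j\<in>S. f j * \<delta> j) \<le> 0"
  using assms(2,3)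
proof (induction "card {j \<in> S. 0 < f j}" arbitrary: f rule: less_induct)
  case less
  let ?P = "{j \<in> S. 0 < f j}"
  show ?case
  proof (cases "?P = {}")
    case True
    then have "\<forall>j\<in>S. f j = 0" using less.prems(1) by force
    then show ?thesis by simp
  next
    case False
    define m where "m = Min (f ` ?P)"
    have fin: "finite ?P" using assms(1) by simp
    have "m \<in> f ` ?P" unfolding m_def using fin False by (intro Min_in) auto
    then obtain p where p: "p \<in> S" "0 < f p" "f p = m" by auto
    have m_le: "m \<le> f j" if "j \<in> S" "0 < f j" for j
      unfolding m_def using fin that by (intro Min_le) auto
    \<comment> \<open>On \<open>S\<close> the condition \<open>m \<le> f j\<close> describes exactly
      the support, since smaller values there are 0.\<close>
    define f' where "f' j = (if m \<le> f j then f j - m else f j)" for j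
    have f'0: "0 \<le> f' j" if "j \<in> S" for j using less.prems(1)[OF that] by (simp add: f'_def)
    have zero: "f' j = 0" if "j \<in> S" "f j < m" for j
    proof -
      have "f j = 0"
        using m_le[OF that(1)] less.prems(1)[OF that(1)] that(2) by (cases "0 < f j") auto
      then show ?thesis using that(2) by (simp add: f'_def)
    qed
    have "f' j \<le> f j" for j using p(2,3) by (simp add: f'_def)
    moreover have "f' p = 0" using p(3) by (simp add: f'_def)
    ultimately have "{j \<in> S. 0 < f' j} \<subseteq> ?P" "p \<in> ?P" "p \<notin> {j \<in> S. 0 < f' j}"
      using p(1,2) by (auto intro: less_le_trans)
    then have "{j \<in> S. 0 < f' j} \<subset> ?P" by blast
    then have lt: "card {j \<in> S. 0 < f' j} < card ?P" by (rule psubset_card_mono[OF fin])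
    have "(\<Sum>j\<in>{j \<in> S. c \<le> f' j}. \<delta> j) \<le> 0" if "0 < c" for c
    proof -
      \<comment> \<open>Level sets of the remainder are level sets of \<open>f\<close> at thresholds
        shifted by \<open>m\<close>, so the hypothesis is inherited.\<close>
      have "c \<le> f' j \<longleftrightarrow> c + m \<le> f j" if "j \<in> S" for j
        using zero[OF that] \<open>0 < c\<close> by (cases "m \<le> f j") (auto simp: f'_def)
      then have "{j \<in> S. c \<le> f' j} = {j \<in> S. c + m \<le> f j}" by blast
      then show ?thesis using less.prems(2)[of "c + m"] that p by simp
    qed
    then have "(\<Sum>j\<in>S. f' j * \<delta> j) \<le> 0" using less.hyps[OF lt] f'0 by blast
    moreover have "m * (\<Sum>j\<in>{j \<in> S. m \<le> f j}. \<delta> j) \<le> 0"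
      using less.prems(2)[of m] p by (simp add: mult_nonneg_nonpos)
    moreover have "(\<Sum>j\<in>S. f j * \<delta> j)
        = (\<Sum>j\<in>S. f' j * \<delta> j) + m * (\<Sum>j\<in>{j \<in> S. m \<le> f j}. \<delta> j)"
      unfolding sum_distrib_left sum.inter_filter[OF assms(1)] sum.distrib[symmetric]
      by (intro sum.cong) (auto simp: f'_def algebra_simps)
    ultimately show ?thesis by linarith
  qed
qed

section \<open>Feasible directions and the first-order condition\<close>

abbreviation load :: "'d set \<Rightarrow> ('d \<times> 's) set \<Rightarrow> ('d \<Rightarrow> 's \<Rightarrow> real) \<Rightarrow> 's \<Rightarrow> real" where
  "load D1 E x j \<equiv> (\<Sum>i\<in>demand_nbrs D1 E j. x i j)"

abbreviation usage :: "'s set \<Rightarrow> ('d \<times> 's) set \<Rightarrow> ('d \<Rightarrow> 's \<Rightarrow> real) \<Rightarrow> 'd \<Rightarrow> real" where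
  "usage S E x i \<equiv> (\<Sum>j\<in>supply_nbrs S E i. x i j)"

text \<open>A slack constraint survives a small step by continuity, a tight one because the slope
  does not point outwards.\<close>

lemma eventually_affine_le:
  fixes a b c :: real
  assumes "a \<le> c" and "a = c \<Longrightarrow> b \<le> 0"
  shows "\<forall>\<^sub>F r in at_right 0. a + r * b \<le> c"
proof (cases "a = c")
  case True
  then show ?thesis using assms(2) eventually_at_right_less[of "0::real"]
    by (auto elim!: eventually_mono intro: mult_nonneg_nonpos)
next
  case False
  have "((\<lambda>r. a + r * b) \<longlongrightarrow> a + 0 * b) (at_right 0)" by (intro tendsto_intros)
  then have "\<forall>\<^sub>F r in at_right 0. a + r * b < c"
    using False assms(1) by (intro order_tendstoD(2)) auto
  then show ?thesis by (auto elim: eventually_mono)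
qed

lemma eventually_feasible_along_direction:
  assumes "finite D1" and "finite S" and "E \<subseteq> D \<times> S" and "feasible D1 S E x"
    and rows: "\<And>i. i \<in> D1 \<Longrightarrow> usage S E x i = 1 \<Longrightarrow> usage S E d i \<le> 0"
    and cols: "\<And>j. j \<in> S \<Longrightarrow> load D1 E x j = 1 \<Longrightarrow> load D1 E d j \<le> 0"
    and entries: "\<And>i j. (i, j) \<in> E \<Longrightarrow> i \<in> D1 \<Longrightarrow> x i j = 0 \<Longrightarrow> 0 \<le> d i j"
  shows "\<forall>\<^sub>F r in at_right 0. feasible D1 S E (\<lambda>i j. x i j + r * d i j)"
proof -
  have feas: "\<And>i. i \<in> D1 \<Longrightarrow> usage S E x i \<le> 1" "\<And>j. j \<in> S \<Longrightarrow> load D1 E x j \<le> 1"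
    "\<And>i j. (i, j) \<in> E \<Longrightarrow> i \<in> D1 \<Longrightarrow> 0 \<le> x i j"
    using assms(4) by (auto simp: feasible_def)
  have "\<forall>\<^sub>F r in at_right 0. \<forall>i\<in>D1. usage S E x i + r * usage S E d i \<le> 1"
    using assms(1) feas(1) rows by (intro eventually_ball_finite ballI eventually_affine_le) auto
  moreover have "\<forall>\<^sub>F r in at_right 0. \<forall>j\<in>S. load D1 E x j + r * load D1 E d j \<le> 1"
    using assms(2) feas(2) cols by (intro eventually_ball_finite ballI eventually_affine_le) auto
  \<comment> \<open>Only edges at \<open>D1\<close> carry variables; being finitely many, their sign
    constraints can be met by a common step size.\<close>
  moreover have "finite (E \<inter> D1 \<times> S)" using assms(1,2) by blast
  then have "\<forall>\<^sub>F r in at_right 0. \<forall>e\<in>E \<inter> D1 \<times> S.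
      - x (fst e) (snd e) + r * (- d (fst e) (snd e)) \<le> 0"
    using feas(3) entries by (intro eventually_ball_finite ballI eventually_affine_le) auto
  ultimately show ?thesis
  proof eventually_elim
    case (elim r)
    have "0 \<le> x i j + r * d i j" if "(i, j) \<in> E" "i \<in> D1" for i j
    proof -
      have "(i, j) \<in> E \<inter> D1 \<times> S" using that assms(3) by blast
      from bspec[OF elim(3) this] show ?thesis by simp
    qed
    with elim(1,2) show ?case
      by (auto simp: feasible_def sum.distrib simp flip: sum_distrib_left)
  qed
qed

text \<open>The sum is minus the directional derivative of the objective along \<open>d\<close>.
  Were it positive, a small feasible step would lower the objective.\<close>

lemma optimal_solution_first_order:
  assumes "finite D1" and "finite S" and "E \<subseteq> D \<times> S" and w: "\<forall>j\<in>S. w j > 0"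
    and deriv: "\<And>a. (h has_real_derivative h' a) (at a)"
    and opt: "optimal_solution D1 S E w h x"
    and rows: "\<And>i. i \<in> D1 \<Longrightarrow> usage S E x i = 1 \<Longrightarrow> usage S E d i \<le> 0"
    and cols: "\<And>j. j \<in> S \<Longrightarrow> load D1 E x j = 1 \<Longrightarrow> load D1 E d j \<le> 0"
    and entries: "\<And>i j. (i, j) \<in> E \<Longrightarrow> i \<in> D1 \<Longrightarrow> x i j = 0 \<Longrightarrow> 0 \<le> d i j"
  shows "(\<Sum>j\<in>S. h' (w j * (1 - load D1 E x j)) * load D1 E d j) \<le> 0"
proof (rule ccontr)
  assume neg: "\<not> ?thesis"
  define F where "F r = objective D1 S E w h (\<lambda>i j. x i j + r * d i j)" for r
  have F_eq: "F = (\<lambda>r. \<Sum>j\<in>S. 1 / w j * h (w j * (1 - (load D1 E x j + r * load D1 E d j))))"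
    by (simp add: F_def objective_def sum.distrib sum_distrib_left fun_eq_iff)
  have "(F has_real_derivative
      (\<Sum>j\<in>S. 1 / w j * (h' (w j * (1 - (load D1 E x j + 0 * load D1 E d j)))
         * (w j * (- load D1 E d j))))) (at 0)"
    unfolding F_eq
    by (intro DERIV_sum DERIV_cmult DERIV_chain2[OF deriv]) (auto intro!: derivative_eq_intros)
  \<comment> \<open>The factor \<open>1 / w j\<close> cancels the inner derivative, so the weights
    survive only inside the argument of \<open>h'\<close>.\<close>
  also have "(\<Sum>j\<in>S. 1 / w j * (h' (w j * (1 - (load D1 E x j + 0 * load D1 E d j)))
         * (w j * (- load D1 E d j))))
      = (\<Sum>j\<in>S. - (h' (w j * (1 - load D1 E x j)) * load D1 E d j))"
    using w by (intro sum.cong) (auto simp: field_simps)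
  also have "\<dots> = - (\<Sum>j\<in>S. h' (w j * (1 - load D1 E x j)) * load D1 E d j)"
    by (rule sum_negf)
  finally have "\<exists>e>0. \<forall>r>0. r < e \<longrightarrow> F (0 + r) < F 0"
    by (rule DERIV_neg_dec_right) (use neg in simp)
  then obtain e where e: "e > 0" "\<And>r. 0 < r \<Longrightarrow> r < e \<Longrightarrow> F r < F 0"
    by auto
  have "\<forall>\<^sub>F r in at_right 0. feasible D1 S E (\<lambda>i j. x i j + r * d i j)"
    using opt by (intro eventually_feasible_along_direction[OF assms(1-3)] rows cols entries)
      (auto simp: optimal_solution_def is_arg_min_def)
  moreover have "\<forall>\<^sub>F r in at_right 0. 0 < r \<and> r < e"
    using e(1) by (auto simp: eventually_at_right)
  ultimately have "\<forall>\<^sub>F r::real in at_right 0. False"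
  proof eventually_elim
    case (elim r)
    then have "F r < F 0" using e(2) by blast
    then show ?case
      using elim(1) opt by (auto simp: F_def optimal_solution_def is_arg_min_def)
  qed
  then show False by simp
qed

section \<open>Alternating exchanges\<close>

text \<open>
  A signed alternating path from \<open>p\<close> to \<open>q\<close>, relaxed to a circulation so that paths compose by
  addition: it moves one unit of load from \<open>q\<close> to \<open>p\<close>.
\<close>

definition exchange ::
  "'d set \<Rightarrow> 's set \<Rightarrow> ('d \<times> 's) set \<Rightarrow> ('d \<Rightarrow> 's \<Rightarrow> real) \<Rightarrow> 's \<Rightarrow> 's \<Rightarrow> ('d \<Rightarrow> 's \<Rightarrow> real) \<Rightarrow> bool"
where
  "exchange D1 S E x p q d \<longleftrightarrow>
     (\<forall>i\<in>D1. usage S E d i = 0) \<and>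
     (\<forall>k\<in>S. load D1 E d k = of_bool (k = p) - of_bool (k = q)) \<and>
     (\<forall>(i, j)\<in>E. i \<in> D1 \<longrightarrow> x i j = 0 \<longrightarrow> 0 \<le> d i j)"

definition unit_flow :: "'d \<Rightarrow> 's \<Rightarrow> 'd \<Rightarrow> 's \<Rightarrow> real" where
  "unit_flow a b i j = of_bool (i = a \<and> j = b)"

lemma usage_unit_flow:
  assumes "finite S" and "(a, b) \<in> E" and "b \<in> S"
  shows "usage S E (unit_flow a b) i = of_bool (i = a)"
proof -
  have "usage S E (unit_flow a b) i = (\<Sum>j\<in>supply_nbrs S E i. if j = b then of_bool (i = a) else 0)"
    by (intro sum.cong) (auto simp: unit_flow_def)
  also have "\<dots> = of_bool (i = a)"
    using assms by (subst sum.delta) (auto simp: supply_nbrs_def)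
  finally show ?thesis .
qed

lemma load_unit_flow:
  assumes "finite D1" and "(a, b) \<in> E" and "a \<in> D1"
  shows "load D1 E (unit_flow a b) j = of_bool (j = b)"
proof -
  have "load D1 E (unit_flow a b) j = (\<Sum>i\<in>demand_nbrs D1 E j. if i = a then of_bool (j = b) else 0)"
    by (intro sum.cong) (auto simp: unit_flow_def)
  also have "\<dots> = of_bool (j = b)"
    using assms by (subst sum.delta) (auto simp: demand_nbrs_def)
  finally show ?thesis .
qed

lemma exchange_refl: "exchange D1 S E x p p (\<lambda>_ _. 0)"
  by (simp add: exchange_def)

text \<open>Prolongs the path by two edges: \<open>i\<close> shifts one unit from \<open>q'\<close>
  to \<open>q\<close>, which moves the deficit from \<open>q\<close> to \<open>q'\<close>. The
  decrease on \<open>(i, q')\<close> is allowed because \<open>x i q'\<close> is nonzero.\<close>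

lemma exchange_step:
  assumes "finite D1" and "finite S" and "E \<subseteq> D \<times> S" and d: "exchange D1 S E x p q d"
    and i: "i \<in> D1" "(i, q) \<in> E" "(i, q') \<in> E" and "x i q' \<noteq> 0"
  shows "exchange D1 S E x p q' (\<lambda>a b. d a b + unit_flow i q a b - unit_flow i q' a b)"
proof -
  have S: "q \<in> S" "q' \<in> S" using assms(3) i by auto
  have "0 \<le> d a b + unit_flow i q a b - unit_flow i q' a b"
    if "(a, b) \<in> E" "a \<in> D1" "x a b = 0" for a b
  proof -
    have "0 \<le> d a b" using d that by (auto simp: exchange_def)
    then show ?thesis using that(3) assms(8) by (auto simp: unit_flow_def)
  qed
  then show ?thesis
    using d usage_unit_flow[OF assms(2) i(2) S(1)] usage_unit_flow[OF assms(2) i(3) S(2)]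
      load_unit_flow[OF assms(1) i(2,1)] load_unit_flow[OF assms(1) i(3,1)]
    by (auto simp: exchange_def sum.distrib sum_subtractf)
qed

section \<open>Reachability certificate for maximal load of an upper set\<close>

lemma sum_load_eq_sum_usage:
  assumes "finite D1" and "finite S" and "R \<subseteq> S"
  shows "(\<Sum>j\<in>R. load D1 E x j) = (\<Sum>i\<in>D1. \<Sum>j\<in>{j \<in> R. (i, j) \<in> E}. x i j)"
proof -
  have "finite R" using assms(2,3) finite_subset by blast
  then show ?thesis
    unfolding demand_nbrs_def
    using sum.swap_restrict[of R D1 "\<lambda>j i. x i j" "\<lambda>j i. (i, j) \<in> E"] assms(1) by simp
qed

lemma upper_set_load_maximal:
  assumes fin: "finite D1" "finite S" and E: "E \<subseteq> D \<times> S" and w: "\<forall>j\<in>S. w j > 0"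
    and deriv: "\<And>a. (h has_real_derivative h' a) (at a)"
    and opt: "optimal_solution D1 S E w h x"
    and pos: "\<And>a. 0 < h' a"
    and A: "A \<subseteq> S"
      "\<And>j k. j \<in> A \<Longrightarrow> k \<in> S - A \<Longrightarrow>
         h' (w k * (1 - load D1 E x k)) < h' (w j * (1 - load D1 E x j))"
    and z: "feasible D1 S E z"
  shows "(\<Sum>j\<in>A. load D1 E z j) \<le> (\<Sum>j\<in>A. load D1 E x j)"
proof -
  have feas: "\<And>i. i \<in> D1 \<Longrightarrow> usage S E x i \<le> 1" "\<And>j. j \<in> S \<Longrightarrow> load D1 E x j \<le> 1"
    "\<And>i j. (i, j) \<in> E \<Longrightarrow> i \<in> D1 \<Longrightarrow> 0 \<le> x i j"
    using opt by (auto simp: feasible_def optimal_solution_def is_arg_min_def)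
  have feasz: "\<And>i. i \<in> D1 \<Longrightarrow> usage S E z i \<le> 1" "\<And>j. j \<in> S \<Longrightarrow> load D1 E z j \<le> 1"
    "\<And>i j. (i, j) \<in> E \<Longrightarrow> i \<in> D1 \<Longrightarrow> 0 \<le> z i j"
    using z by (auto simp: feasible_def)
  define v where "v j = h' (w j * (1 - load D1 E x j))" for j
  \<comment> \<open>\<open>R\<close> collects the endpoints of exchanges starting at unsaturated
    vertices of \<open>A\<close>.\<close>
  define R where "R = {q \<in> S. \<exists>p\<in>A. load D1 E x p < 1 \<and> (\<exists>d. exchange D1 S E x p q d)}"
  have first_order: "(\<Sum>j\<in>S. v j * load D1 E d j) \<le> 0"
    if "\<And>i. i \<in> D1 \<Longrightarrow> usage S E x i = 1 \<Longrightarrow> usage S E d i \<le> 0"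
      and "\<And>j. j \<in> S \<Longrightarrow> load D1 E x j = 1 \<Longrightarrow> load D1 E d j \<le> 0"
      and "\<And>i j. (i, j) \<in> E \<Longrightarrow> i \<in> D1 \<Longrightarrow> x i j = 0 \<Longrightarrow> 0 \<le> d i j" for d
    unfolding v_def by (rule optimal_solution_first_order[OF fin E w deriv opt that])
  \<comment> \<open>An exchange leaving \<open>A\<close> would have first-order gain
    \<open>v p - v q\<close>, which is positive by the separation of \<open>A\<close> from its
    complement.\<close>
  have R_A: "q \<in> A" if "q \<in> R" for q
  proof (rule ccontr)
    assume q: "q \<notin> A"
    from that obtain p d where p: "q \<in> S" "p \<in> A" "load D1 E x p < 1" "exchange D1 S E x p q d"
      by (auto simp: R_def)
    have ld: "load D1 E d k = of_bool (k = p) - of_bool (k = q)" if "k \<in> S" for k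
      using p(4) that by (simp add: exchange_def)
    have "(\<Sum>j\<in>S. v j * load D1 E d j) \<le> 0"
      using p(3,4) by (intro first_order) (auto simp: exchange_def)
    also have "(\<Sum>j\<in>S. v j * load D1 E d j)
        = (\<Sum>j\<in>S. (if j = p then v j else 0) - (if j = q then v j else 0))"
      by (intro sum.cong) (auto simp: ld)
    also have "\<dots> = v p - v q"
      using fin(2) p(1,2) A(1) by (auto simp: sum_subtractf)
    finally show False using A(2)[OF p(2), of q] p(1) q by (simp add: v_def)
  qed
  have R_start: "p \<in> R" if "p \<in> A" "load D1 E x p < 1" for p
    using that A(1) exchange_refl[of D1 S E x p] by (auto simp: R_def)
  have R_step: "q' \<in> R" if "q \<in> R" "i \<in> D1" "(i, q) \<in> E" "(i, q') \<in> E" "x i q' \<noteq> 0" for i q q'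
  proof -
    from that(1) obtain p d where p: "p \<in> A" "load D1 E x p < 1" "exchange D1 S E x p q d"
      by (auto simp: R_def)
    show ?thesis
      using p(1,2) E that(4) exchange_step[OF fin E p(3) that(2-5)] by (auto simp: R_def)
  qed
  \<comment> \<open>A slack \<open>i\<close> could refill the deficit at \<open>q\<close>. The net
    effect would be extra load at \<open>p\<close> alone, with gain \<open>v p > 0\<close>.\<close>
  have tight: "usage S E x i = 1" if q: "q \<in> R" and i: "i \<in> D1" "(i, q) \<in> E" for i q
  proof (rule ccontr)
    assume slack: "usage S E x i \<noteq> 1"
    from q obtain p d where p: "q \<in> S" "p \<in> A" "load D1 E x p < 1" "exchange D1 S E x p q d"
      by (auto simp: R_def)
    let ?d = "\<lambda>a b. d a b + unit_flow i q a b"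
    have us: "usage S E ?d a = of_bool (a = i)" if "a \<in> D1" for a
      using p(4) that usage_unit_flow[OF fin(2) i(2) p(1)] by (simp add: exchange_def sum.distrib)
    have ld: "load D1 E ?d k = of_bool (k = p)" if "k \<in> S" for k
      using p(4) that load_unit_flow[OF fin(1) i(2,1)] by (simp add: exchange_def sum.distrib)
    have "0 \<le> ?d a b" if "(a, b) \<in> E" "a \<in> D1" "x a b = 0" for a b
      using p(4) that by (auto simp: exchange_def unit_flow_def)
    then have "(\<Sum>j\<in>S. v j * load D1 E ?d j) \<le> 0"
      using p(3) slack by (intro first_order) (auto simp: us ld)
    also have "(\<Sum>j\<in>S. v j * load D1 E ?d j) = (\<Sum>j\<in>S. if j = p then v j else 0)"
      by (intro sum.cong) (auto simp: ld)
    also have "\<dots> = v p" using fin(2) p(2) A(1) by auto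
    finally show False using pos[of "w p * (1 - load D1 E x p)"] by (simp add: v_def)
  qed
  have R_S: "R \<subseteq> S" by (auto simp: R_def)
  \<comment> \<open>A demand vertex adjacent to \<open>R\<close> is saturated by \<open>x\<close>
    and, by \<open>R_step\<close>, sends everything into \<open>R\<close>; no feasible
    \<open>z\<close> can send more.\<close>
  have "(\<Sum>j\<in>{j \<in> R. (i, j) \<in> E}. z i j) \<le> (\<Sum>j\<in>{j \<in> R. (i, j) \<in> E}. x i j)"
    if i: "i \<in> D1" for i
  proof (cases "\<exists>q\<in>R. (i, q) \<in> E")
    case True
    then obtain q where q: "q \<in> R" "(i, q) \<in> E" by blast
    have sub: "{j \<in> R. (i, j) \<in> E} \<subseteq> supply_nbrs S E i" and finN: "finite (supply_nbrs S E i)"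
      using R_S fin(2) by (auto simp: supply_nbrs_def)
    have "(\<Sum>j\<in>{j \<in> R. (i, j) \<in> E}. z i j) \<le> usage S E z i"
      using feasz(3) i by (intro sum_mono2[OF finN sub]) (auto simp: supply_nbrs_def)
    also have "\<dots> \<le> 1" using feasz(1) i by blast
    also have "\<dots> = usage S E x i" using tight[OF q(1) i q(2)] by simp
    also have "\<dots> = (\<Sum>j\<in>{j \<in> R. (i, j) \<in> E}. x i j)"
      using R_step[OF q(1) i q(2)]
      by (intro sum.mono_neutral_right[OF finN sub]) (auto simp: supply_nbrs_def)
    finally show ?thesis .
  next
    case False
    then have "{j \<in> R. (i, j) \<in> E} = {}" by blast
    then show ?thesis by (simp only: sum.empty)
  qed
  then have "(\<Sum>j\<in>R. load D1 E z j) \<le> (\<Sum>j\<in>R. load D1 E x j)"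
    unfolding sum_load_eq_sum_usage[OF fin R_S] by (rule sum_mono)
  \<comment> \<open>Unsaturated vertices of \<open>A\<close> lie in \<open>R\<close> by the zero
    exchange, so those left over already have full load.\<close>
  moreover have "(\<Sum>j\<in>A - R. load D1 E z j) \<le> (\<Sum>j\<in>A - R. load D1 E x j)"
  proof (rule sum_mono)
    fix j assume j: "j \<in> A - R"
    then have "load D1 E x j = 1" using R_start[of j] feas(2)[of j] A(1) by force
    then show "load D1 E z j \<le> load D1 E x j" using feasz(2)[of j] j A(1) by auto
  qed
  moreover have "finite A" "R \<subseteq> A" using A(1) fin(2) finite_subset R_A by auto
  ultimately show ?thesis by (simp add: sum.subset_diff[of R A])
qed

section \<open>Transfer of optimality from \<open>g_hat\<close> to \<open>g\<close>\<close>

lemma differentiable_on_UNIV_deriv: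
  fixes f :: "real \<Rightarrow> real"
  assumes "f differentiable_on UNIV"
  shows "(f has_real_derivative deriv f a) (at a)"
  using assms by (simp add: differentiable_on_def DERIV_deriv_iff_real_differentiable)

theorem mainTheorem9:
  fixes D D1 D2 :: "'d set" and S :: "'s set" and E :: "('d \<times> 's) set"
    and w :: "'s \<Rightarrow> real" and g_hat g :: "real \<Rightarrow> real" and x :: "'d \<Rightarrow> 's \<Rightarrow> real"
  assumes "bipartite_graph D S E"
    and "D = D1 \<union> D2" and "D1 \<inter> D2 = {}"
    and "\<forall>j\<in>S. w j > 0"
    and "g_hat differentiable_on UNIV" and "mono g_hat" and "strictly_convex_on UNIV g_hat"
    and "g differentiable_on UNIV" and "mono g" and "strictly_convex_on UNIV g"
    and "optimal_solution D1 S E w g_hat x"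
  shows "optimal_solution D1 S E w g x"
proof -
  have fin: "finite D1" "finite S" and E: "E \<subseteq> D \<times> S"
    using assms(1,2) by (auto simp: bipartite_graph_def)
  note dg_hat = differentiable_on_UNIV_deriv[OF assms(5)]
  note dg = differentiable_on_UNIV_deriv[OF assms(8)]
  define t where "t j = w j * (1 - load D1 E x j)" for j
  have "objective D1 S E w g x \<le> objective D1 S E w g z" if z: "feasible D1 S E z" for z
  proof -
    define \<delta> where "\<delta> j = load D1 E z j - load D1 E x j" for j
    have "(\<Sum>j\<in>S. deriv g (t j) * \<delta> j) \<le> 0"
    proof (rule weighted_sum_nonpos_if_level_sums_nonpos[OF fin(2)])
      show "0 \<le> deriv g (t j)" for j
        using mono_strictly_convex_deriv_pos[OF assms(10) dg assms(9)] by (simp add: less_imp_le)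
      fix c :: real
      let ?A = "{j \<in> S. c \<le> deriv g (t j)}"
      \<comment> \<open>The two functions meet only through the order of \<open>t\<close>:
        \<open>deriv g\<close> reflects it, so \<open>?A\<close> is an upper set of
        \<open>t\<close>, and \<open>deriv g_hat\<close> preserves it.\<close>
      have "deriv g_hat (t k) < deriv g_hat (t j)" if "j \<in> ?A" "k \<in> S - ?A" for j k
      proof (rule strictly_convex_deriv_strict_mono[OF assms(7) dg_hat])
        have "deriv g (t k) < deriv g (t j)" using that by auto
        then show "t k < t j"
          using strictly_convex_deriv_strict_mono[OF assms(10) dg, of "t j" "t k"]
          by (cases "t j" "t k" rule: linorder_cases) auto
      qed
      then have "(\<Sum>j\<in>?A. load D1 E z j) \<le> (\<Sum>j\<in>?A. load D1 E x j)"
        using mono_strictly_convex_deriv_pos[OF assms(7) dg_hat assms(6)] z unfolding t_def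
        by (intro upper_set_load_maximal[OF fin E assms(4) dg_hat assms(11)]) auto
      then show "(\<Sum>j\<in>?A. \<delta> j) \<le> 0" by (simp add: \<delta>_def sum_subtractf)
    qed
    then have "objective D1 S E w g x
        \<le> (\<Sum>j\<in>S. 1 / w j * g (t j)) - (\<Sum>j\<in>S. deriv g (t j) * \<delta> j)"
      by (simp add: objective_def t_def)
    \<comment> \<open>Here \<open>w j * (1 - load D1 E z j) - t j\<close> equals
      \<open>- w j * \<delta> j\<close>, so the subtracted sum is the linear term of the tangents at
      \<open>t j\<close>.\<close>
    also have "\<dots> = (\<Sum>j\<in>S. 1 / w j * (g (t j) + deriv g (t j) * (w j * (1 - load D1 E z j) - t j)))"
      unfolding sum_subtractf[symmetric]
      using assms(4) by (intro sum.cong) (auto simp: \<delta>_def t_def field_simps)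
    also have "\<dots> \<le> objective D1 S E w g z"
      unfolding objective_def
      using assms(4) strictly_convex_above_tangent[OF assms(10) dg]
      by (intro sum_mono mult_left_mono) (auto intro: less_imp_le)
    finally show ?thesis .
  qed
  then show ?thesis
    using assms(11) by (force simp: optimal_solution_def is_arg_min_def not_less)
qed

end
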